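(* Let $\mathbb{F}$ be an algebraically closed field with $\mathrm{Char}(\mathbb{F})\neq 2$, let $p\in\mathbb{F}$ with $p\ne 0$, $p\neq 1$, let $N$ be a feasible integer, let $L=\mathfrak{sl}_2(\mathbb{F})$, and let $V=\mathrm{Hom}_N(\mathbb{F}[y,z])$. Let $\langle\,,\,\rangle:V\times V\to\mathbb{F}$ be the bilinear form with $$\langle y^{N-i}z^i,y^{N-j}z^j\rangle=\delta_{i,j}\frac{1}{k_i(1-p)^N},\qquad i,j=0,1,\ldots,N,\qquad k_i=\binom{N}{i}\left(\frac{p}{1-p}\right)^i .$$ Then for all $\varphi\in L$ and $u,v\in V$, $$\langle\varphi.u,v\rangle=\langle u,\varphi^\dagger.v\rangle,$$ where $\dagger$ is the unique antiautomorphism of $L$ that fixes each of $a=2(1-p)e+(1-2p)h+2pf$ and $a^*=h$.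
   Context: $L=\mathfrak{sl}_2(\mathbb{F})$ is the Lie algebra of trace-zero $2\times 2$ matrices over $\mathbb{F}$ with bracket $[u,v]=uv-vu$, and basis $e=\begin{pmatrix}0&1\\0&0\end{pmatrix}$, $h=\begin{pmatrix}1&0\\0&-1\end{pmatrix}$, $f=\begin{pmatrix}0&0\\1&0\end{pmatrix}$. An integer $N$ is feasible if $N\ge 0$ when $\mathrm{Char}(\mathbb{F})=0$, and $0\le N<\mathrm{Char}(\mathbb{F})$ when $\mathrm{Char}(\mathbb{F})>0$. $L$ acts on $\mathbb{F}[y,z]$ ($y,z$ commuting indeterminates) by derivations, determined by $e.y=0$, $h.y=y$, $f.y=z$, $e.z=y$, $h.z=-z$, $f.z=0$. The subspace $\mathrm{Hom}_N(\mathbb{F}[y,z])=\mathrm{Span}\{y^{N-i}z^i\}_{i=0}^N$ is an $L$-submodule. An antiautomorphism of $L$ is an isomorphism of $\mathbb{F}$-vector spaces $\sigma:L\to L$ such that $[u,v]^\sigma=[v^\sigma,u^\sigma]$ for all $u,v\in L$. There is a unique antiautomorphism $\dagger$ of $L$ fixing both $a$ and $a^*$. *)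

theory Defs
  imports "HOL-Analysis.Analysis" "HOL-Computational_Algebra.Polynomial"
begin

definition sl2 :: "('a::field ^ 2 ^ 2) set" where
  "sl2 = {A. trace A = 0}"

definition bracket :: "'a::field ^ 2 ^ 2 \<Rightarrow> 'a ^ 2 ^ 2 \<Rightarrow> 'a ^ 2 ^ 2" where
  "bracket A B = A ** B - B ** A"

definition smult_mat :: "'a::field \<Rightarrow> 'a ^ 2 ^ 2 \<Rightarrow> 'a ^ 2 ^ 2" where
  "smult_mat c A = (\<chi> i j. c * A $ i $ j)"

definition sl2_e :: "'a::field ^ 2 ^ 2" where
  "sl2_e = vector [vector [0, 1], vector [0, 0]]"

definition sl2_h :: "'a::field ^ 2 ^ 2" where
  "sl2_h = vector [vector [1, 0], vector [0, -1]]"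

definition sl2_f :: "'a::field ^ 2 ^ 2" where
  "sl2_f = vector [vector [0, 0], vector [1, 0]]"

definition sl2_a :: "'a::field \<Rightarrow> 'a ^ 2 ^ 2" where
  "sl2_a p = smult_mat (2 * (1 - p)) sl2_e + smult_mat (1 - 2 * p) sl2_h + smult_mat (2 * p) sl2_f"

definition sl2_astar :: "'a::field ^ 2 ^ 2" where
  "sl2_astar = sl2_h"

definition antiautomorphism :: "('a::field ^ 2 ^ 2 \<Rightarrow> 'a ^ 2 ^ 2) \<Rightarrow> bool" where
  "antiautomorphism \<sigma> \<longleftrightarrow>
     bij_betw \<sigma> sl2 sl2 \<and>
     (\<forall>A\<in>sl2. \<forall>B\<in>sl2. \<sigma> (A + B) = \<sigma> A + \<sigma> B) \<and>
     (\<forall>c. \<forall>A\<in>sl2. \<sigma> (smult_mat c A) = smult_mat c (\<sigma> A)) \<and>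
     (\<forall>A\<in>sl2. \<forall>B\<in>sl2. \<sigma> (bracket A B) = bracket (\<sigma> B) (\<sigma> A))"

text \<open>A map on \<^const>\<open>sl2\<close> is encoded as a function on all matrices that is
  \<^const>\<open>undefined\<close> off \<^const>\<open>sl2\<close>, so that uniqueness is meaningful;
  \<open>dagger_exists_unique\<close> below shows that the description is proper.\<close>

definition dagger :: "'a::field \<Rightarrow> 'a ^ 2 ^ 2 \<Rightarrow> 'a ^ 2 ^ 2" where
  "dagger p = (THE \<sigma>. \<sigma> \<in> extensional sl2 \<and> antiautomorphism \<sigma> \<and>
                 \<sigma> (sl2_a p) = sl2_a p \<and> \<sigma> sl2_astar = sl2_astar)"

lemmas mat2_simps = vec_eq_iff forall_2 sum_2 matrix_matrix_mult_def trace_def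
  sl2_def bracket_def smult_mat_def sl2_e_def sl2_h_def sl2_f_def sl2_a_def sl2_astar_def

lemma sl2_basis_in_sl2: "sl2_e \<in> sl2" "sl2_h \<in> sl2" "sl2_f \<in> sl2" "sl2_a p \<in> sl2"
  by (simp_all add: mat2_simps)

lemma sl2_closed:
  "A \<in> sl2 \<Longrightarrow> B \<in> sl2 \<Longrightarrow> A + B \<in> sl2"
  "A \<in> sl2 \<Longrightarrow> smult_mat c A \<in> sl2"
  "bracket A B \<in> sl2"
  by (auto simp: mat2_simps algebra_simps simp flip: distrib_left)

lemma sl2_expand:
  assumes "A \<in> sl2"
  shows "A = smult_mat (A$1$2) sl2_e + (smult_mat (A$1$1) sl2_h + smult_mat (A$2$1) sl2_f)"
  using assms by (simp add: mat2_simps add_eq_0_iff)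

lemma antiautomorphism_fixing_values:
  fixes p :: "'a::field"
  assumes "(2::'a) \<noteq> 0" "p \<noteq> 0" "p \<noteq> 1" and \<sigma>: "antiautomorphism \<sigma>"
    and a: "\<sigma> (sl2_a p) = sl2_a p" and h: "\<sigma> sl2_astar = sl2_astar"
  shows "\<sigma> sl2_e = smult_mat (p / (1 - p)) sl2_f" "\<sigma> sl2_f = smult_mat ((1 - p) / p) sl2_e"
proof -
  have add: "\<sigma> (A + B) = \<sigma> A + \<sigma> B" if "A \<in> sl2" "B \<in> sl2" for A B
    using \<sigma> that by (auto simp: antiautomorphism_def)
  have smult: "\<sigma> (smult_mat c A) = smult_mat c (\<sigma> A)" if "A \<in> sl2" for A c
    using \<sigma> that by (auto simp: antiautomorphism_def)
  have br: "\<sigma> (bracket A B) = bracket (\<sigma> B) (\<sigma> A)" if "A \<in> sl2" "B \<in> sl2" for A B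
    using \<sigma> that by (auto simp: antiautomorphism_def)
  let ?a = "sl2_a p" and ?h = "sl2_astar :: 'a ^ 2 ^ 2"
  let ?b = "bracket ?a ?h"
  have hin: "?h \<in> sl2" using sl2_basis_in_sl2 by (simp add: sl2_astar_def)
  note mem = sl2_basis_in_sl2 hin sl2_closed
  have b: "\<sigma> ?b = bracket ?h ?a"
    using br[of ?a ?h] by (simp add: a h mem)
  have q: "1 - p \<noteq> 0" using assms by auto
  have four: "(4::'a) \<noteq> 0" using assms(1) by (metis mult_2 numeral_Bit0 mult_eq_0_iff)
  have eight: "(8::'a) \<noteq> 0" using four by (metis mult_2 numeral_Bit0 mult_eq_0_iff assms(1))
  have e: "sl2_e = smult_mat (1 / (4 * (1 - p))) (?a + (smult_mat (- (1 - 2 * p)) ?h + smult_mat (- 1 / 2) ?b))"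
    using q assms(1-3) four eight by (simp add: mat2_simps field_simps)
  have f: "sl2_f = smult_mat (1 / (4 * p)) (?a + (smult_mat (- (1 - 2 * p)) ?h + smult_mat (1 / 2) ?b))"
    using q assms(1-3) four eight by (simp add: mat2_simps field_simps)
  have "\<sigma> sl2_e = smult_mat (1 / (4 * (1 - p))) (?a + (smult_mat (- (1 - 2 * p)) ?h + smult_mat (- 1 / 2) (bracket ?h ?a)))"
    by (subst e) (simp add: add smult mem a h b)
  also have "\<dots> = smult_mat (p / (1 - p)) sl2_f"
    using q assms(1-3) four eight by (simp add: mat2_simps field_simps)
  finally show "\<sigma> sl2_e = smult_mat (p / (1 - p)) sl2_f" .
  have "\<sigma> sl2_f = smult_mat (1 / (4 * p)) (?a + (smult_mat (- (1 - 2 * p)) ?h + smult_mat (1 / 2) (bracket ?h ?a)))"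
    by (subst f) (simp add: add smult mem a h b)
  also have "\<dots> = smult_mat ((1 - p) / p) sl2_e"
    using q assms(1-3) four eight by (simp add: mat2_simps field_simps)
  finally show "\<sigma> sl2_f = smult_mat ((1 - p) / p) sl2_e" .
qed

lemma dagger_exists_unique:
  fixes p :: "'a::field"
  assumes "CHAR('a) \<noteq> 2" "p \<noteq> 0" "p \<noteq> 1"
  shows "\<exists>!\<sigma>. \<sigma> \<in> extensional sl2 \<and> antiautomorphism \<sigma> \<and>
            \<sigma> (sl2_a p) = sl2_a p \<and> \<sigma> sl2_astar = sl2_astar"
proof -
  have two: "(2::'a) \<noteq> 0"
  proof
    assume "(2::'a) = 0"
    then have "of_nat 2 = (0::'a)" by simp
    then have "CHAR('a) dvd 2" by (simp only: of_nat_eq_0_iff_char_dvd)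
    then have "CHAR('a) \<le> 2" by (rule dvd_imp_le) simp
    moreover have "CHAR('a) \<noteq> 0" using \<open>CHAR('a) dvd 2\<close> by (intro notI) simp
    moreover have "CHAR('a) \<noteq> 1" by simp
    ultimately show False using assms(1) by linarith
  qed
  have q: "1 - p \<noteq> 0" using assms by auto
  define s where "s = (1 - p) / p"
  define t where "t = p / (1 - p)"
  have st: "s * t = 1" "s * (t * x) = x" "t * (s * x) = x" for x
    using q assms by (simp_all add: s_def t_def)
  have sp: "s * p = 1 - p" "t * (1 - p) = p"
    using q assms by (simp_all add: s_def t_def)
  define T :: "'a ^ 2 ^ 2 \<Rightarrow> 'a ^ 2 ^ 2" where
    "T A = vector [vector [A$1$1, s * A$2$1], vector [t * A$1$2, A$2$2]]" for A
  have Ta: "T (sl2_a p) = sl2_a p"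
    using q assms by (simp add: T_def mat2_simps s_def t_def field_simps)
  have Tbr: "T (bracket A B) = bracket (T B) (T A)" for A B
  proof -
    have eq: "s * x * (t * y) = x * y" "t * x * (s * y) = x * y" for x y
      using st(1) by (metis mult.assoc mult.left_commute mult.right_neutral mult.commute)+
    show ?thesis by (simp add: T_def mat2_simps eq) (simp add: algebra_simps)
  qed
  have T: "T A \<in> sl2" "T (T A) = A" "T (A + B) = T A + T B" "T (smult_mat c A) = smult_mat c (T A)"
    "T sl2_astar = sl2_astar"
    if "A \<in> sl2" for A B c
    using that st by (simp_all add: T_def mat2_simps algebra_simps)
  have ex: "antiautomorphism (restrict T sl2)"
    unfolding antiautomorphism_def
  proof (intro conjI ballI allI)
    show "bij_betw (restrict T sl2) sl2 sl2"
      by (rule bij_betw_byWitness[where f' = T]) (auto simp: T)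
  qed (auto simp: T Tbr sl2_closed)
  show ?thesis
  proof (rule ex1I[where a = "restrict T sl2"])
    show "restrict T sl2 \<in> extensional sl2 \<and> antiautomorphism (restrict T sl2) \<and>
        restrict T sl2 (sl2_a p) = sl2_a p \<and> restrict T sl2 sl2_astar = sl2_astar"
      using ex T(5)[OF sl2_basis_in_sl2(2)] by (simp add: Ta sl2_basis_in_sl2 sl2_astar_def)
  next
    fix \<sigma> :: "'a ^ 2 ^ 2 \<Rightarrow> 'a ^ 2 ^ 2"
    assume \<sigma>: "\<sigma> \<in> extensional sl2 \<and> antiautomorphism \<sigma> \<and>
        \<sigma> (sl2_a p) = sl2_a p \<and> \<sigma> sl2_astar = sl2_astar"
    then have anti: "antiautomorphism \<sigma>" by blast
    note v = antiautomorphism_fixing_values[OF two assms(2,3) anti]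
    show "\<sigma> = restrict T sl2"
    proof (rule extensionalityI)
      fix A :: "'a ^ 2 ^ 2" assume A: "A \<in> sl2"
      have "\<sigma> A = smult_mat (A$1$2) (\<sigma> sl2_e) +
          (smult_mat (A$1$1) (\<sigma> sl2_h) + smult_mat (A$2$1) (\<sigma> sl2_f))"
        using anti by (subst sl2_expand[OF A])
          (simp add: antiautomorphism_def sl2_closed sl2_basis_in_sl2)
      also have "\<dots> = T A"
        using A \<sigma> v by (simp add: sl2_astar_def) (simp add: T_def mat2_simps add_eq_0_iff s_def t_def)
      finally show "\<sigma> A = restrict T sl2 A" using A by simp
    qed (use \<sigma> in auto)
  qed
qed

text \<open>The ring of polynomials in \<open>y\<close> and \<open>z\<close> is \<^typ>\<open>'a poly poly\<close>: the indeterminate of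
  the coefficient ring is \<open>y\<close>, the outer one is \<open>z\<close>.\<close>

definition var_y :: "'a::field poly poly" where
  "var_y = [:[:0, 1:]:]"

definition var_z :: "'a::field poly poly" where
  "var_z = [:0, 1:]"

definition cscale :: "'a::field \<Rightarrow> 'a poly poly \<Rightarrow> 'a poly poly" where
  "cscale c q = smult [:c:] q"

interpretation poly2: vector_space cscale
  by unfold_locales
    (simp_all add: cscale_def smult_add_right mult.commute flip: smult_add_left one_pCons)

lemma cscale_mult: "cscale c q * r = cscale c (q * r)" "q * cscale c r = cscale c (q * r)"
  by (simp_all add: cscale_def)

definition Hom :: "nat \<Rightarrow> 'a::field poly poly set" where
  "Hom N = poly2.span {var_y ^ (N - i) * var_z ^ i | i. i \<le> N}"

definition partial_y :: "'a::field poly poly \<Rightarrow> 'a poly poly" where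
  "partial_y = map_poly pderiv"

definition partial_z :: "'a::field poly poly \<Rightarrow> 'a poly poly" where
  "partial_z = pderiv"

text \<open>A derivation is determined by its values at \<open>y\<close> and \<open>z\<close>. On the span of \<open>y\<close> and
  \<open>z\<close> the matrix \<open>A\<close> acts as on column vectors, which gives the prescribed values at
  \<^const>\<open>sl2_e\<close>, \<^const>\<open>sl2_h\<close> and \<^const>\<open>sl2_f\<close> (\<open>act_basis\<close>).
  The lemmas \<open>act_derivation\<close>, \<open>act_linear\<close>, \<open>act_bracket\<close> and \<open>derivation_unique\<close> show that
  this is the only Lie algebra action by derivations with these values.\<close>

definition act :: "'a::field ^ 2 ^ 2 \<Rightarrow> 'a poly poly \<Rightarrow> 'a poly poly" where
  "act A q = (cscale (A$1$1) var_y + cscale (A$2$1) var_z) * partial_y q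
           + (cscale (A$1$2) var_y + cscale (A$2$2) var_z) * partial_z q"

definition derivation :: "('a::field poly poly \<Rightarrow> 'a poly poly) \<Rightarrow> bool" where
  "derivation D \<longleftrightarrow> (\<forall>q r. D (q + r) = D q + D r) \<and> (\<forall>c q. D (cscale c q) = cscale c (D q)) \<and>
     (\<forall>q r. D (q * r) = D q * r + q * D r)"

lemma pderiv_sum_poly: "pderiv (sum g S) = (\<Sum>x\<in>S. pderiv (g x))"
  for g :: "'b \<Rightarrow> 'a::field poly"
  by (induction S rule: infinite_finite_induct) (simp_all add: pderiv_add)

lemma derivation_partial_y: "derivation partial_y"
  unfolding derivation_def
proof (intro conjI allI)
  fix q r :: "'a poly poly" and c :: 'a
  show "partial_y (q + r) = partial_y q + partial_y r"
    by (rule poly_eqI) (simp add: partial_y_def coeff_map_poly pderiv_add)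
  show "partial_y (cscale c q) = cscale c (partial_y q)"
    by (rule poly_eqI) (simp add: partial_y_def cscale_def coeff_map_poly pderiv_smult)
  show "partial_y (q * r) = partial_y q * r + q * partial_y r"
  proof (rule poly_eqI)
    fix n
    show "coeff (partial_y (q * r)) n = coeff (partial_y q * r + q * partial_y r) n"
      by (simp add: partial_y_def coeff_map_poly coeff_mult pderiv_sum_poly pderiv_mult sum.distrib)
        (simp add: mult.commute add.commute)
  qed
qed

lemma derivation_partial_z: "derivation partial_z"
  by (simp add: derivation_def partial_z_def cscale_def pderiv_add pderiv_smult pderiv_mult algebra_simps)

lemma partial_vars:
  "partial_y var_y = 1" "partial_y var_z = 0" "partial_z var_y = 0" "partial_z var_z = 1"
  by (simp_all add: partial_y_def partial_z_def var_y_def var_z_def map_poly_pCons pderiv_pCons one_pCons)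

lemma act_derivation: "derivation (act A)"
proof -
  have "partial_y (q + r) = partial_y q + partial_y r" "partial_z (q + r) = partial_z q + partial_z r"
    "partial_y (cscale c q) = cscale c (partial_y q)" "partial_z (cscale c q) = cscale c (partial_z q)"
    "partial_y (q * r) = partial_y q * r + q * partial_y r"
    "partial_z (q * r) = partial_z q * r + q * partial_z r" for q r :: "'a poly poly" and c
    using derivation_partial_y derivation_partial_z unfolding derivation_def by blast+
  then show ?thesis
    unfolding derivation_def act_def by (simp add: cscale_mult poly2.scale_right_distrib poly2.scale_left_commute algebra_simps)
qed

lemma act_vars:
  "act A var_y = cscale (A$1$1) var_y + cscale (A$2$1) var_z"
  "act A var_z = cscale (A$1$2) var_y + cscale (A$2$2) var_z"
  by (simp_all add: act_def partial_vars)

lemma act_basis: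
  "act sl2_e var_y = 0" "act sl2_h var_y = var_y" "act sl2_f var_y = var_z"
  "act sl2_e var_z = var_y" "act sl2_h var_z = - var_z" "act sl2_f var_z = 0"
  by (simp_all add: act_vars sl2_e_def sl2_h_def sl2_f_def)

lemma act_linear:
  "act (A + B) q = act A q + act B q" "act (smult_mat c A) q = cscale c (act A q)"
proof -
  show "act (A + B) q = act A q + act B q"
    by (simp add: act_def poly2.scale_left_distrib algebra_simps)
  show "act (smult_mat c A) q = cscale c (act A q)"
    by (simp add: act_def smult_mat_def cscale_mult poly2.scale_right_distrib algebra_simps)
qed

lemma derivation_unique:
  assumes D: "derivation D" and E: "derivation E" and y: "D var_y = E var_y" and z: "D var_z = E var_z"
  shows "D = E"
proof
  fix q
  have one: "F 1 = 0" if "derivation F" for F :: "'a poly poly \<Rightarrow> 'a poly poly"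
  proof -
    have "F (1 * 1) = F 1 * 1 + 1 * F 1" using that unfolding derivation_def by blast
    then show ?thesis by (metis add_cancel_right_right mult.right_neutral mult_1)
  qed
  have const: "F [:[:c:]:] = 0" if "derivation F" for F :: "'a poly poly \<Rightarrow> 'a poly poly" and c
  proof -
    have "F (cscale c 1) = cscale c (F 1)" using that unfolding derivation_def by blast
    moreover have "cscale c 1 = [:[:c:]:]" by (simp add: cscale_def one_pCons)
    ultimately show ?thesis by (simp add: one[OF that] cscale_def)
  qed
  have zero: "F 0 = 0" if "derivation F" for F :: "'a poly poly \<Rightarrow> 'a poly poly"
    using const[OF that, of 0] by simp
  have lin: "F (u + x * v) = F u + (F x * v + x * F v)" if "derivation F"
    for F :: "'a poly poly \<Rightarrow> 'a poly poly" and u v x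
    using that by (simp add: derivation_def)
  have inner: "D [:r:] = E [:r:]" for r
  proof (induction r)
    case 0
    then show ?case by (simp add: zero D E)
  next
    case (pCons c r)
    have "[:pCons c r:] = [:[:c:]:] + var_y * [:r:]" by (simp add: var_y_def)
    then show ?case using lin[OF D] lin[OF E] by (metis pCons.IH y const[OF D] const[OF E])
  qed
  show "D q = E q"
  proof (induction q)
    case 0
    then show ?case by (simp add: zero D E)
  next
    case (pCons c r)
    have "pCons c r = [:c:] + var_z * r" by (simp add: var_z_def)
    then show ?case using lin[OF D] lin[OF E] by (metis pCons.IH z inner)
  qed
qed

lemma act_bracket: "act (bracket A B) q = act A (act B q) - act B (act A q)"
proof -
  let ?C = "\<lambda>q. act A (act B q) - act B (act A q)"
  have add: "act X (q + r) = act X q + act X r"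
    and sc: "act X (cscale c q) = cscale c (act X q)"
    and mult: "act X (q * r) = act X q * r + q * act X r" for X :: "'a^2^2" and c q r
    using act_derivation[of X] by (auto simp: derivation_def)
  have "derivation ?C"
    unfolding derivation_def by (simp add: add sc mult algebra_simps poly2.scale_right_diff_distrib)
  moreover have "act (bracket A B) var_y = ?C var_y" "act (bracket A B) var_z = ?C var_z"
    by (simp_all add: act_vars add sc bracket_def matrix_matrix_mult_def sum_2
        poly2.scale_right_distrib poly2.scale_left_distrib poly2.scale_left_diff_distrib
        algebra_simps)
  ultimately have "act (bracket A B) = ?C"
    by (intro derivation_unique act_derivation)
  then show ?thesis by (rule fun_cong)
qed

definition feasible :: "'a::field itself \<Rightarrow> nat \<Rightarrow> bool" where
  "feasible _ N \<longleftrightarrow> CHAR('a) = 0 \<or> N < CHAR('a)"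

definition bilinear_form_on ::
    "'a::field poly poly set \<Rightarrow> ('a poly poly \<Rightarrow> 'a poly poly \<Rightarrow> 'a) \<Rightarrow> bool" where
  "bilinear_form_on V B \<longleftrightarrow>
     (\<forall>u\<in>V. \<forall>v\<in>V. \<forall>w\<in>V. B (u + v) w = B u w + B v w \<and> B w (u + v) = B w u + B w v) \<and>
     (\<forall>c. \<forall>u\<in>V. \<forall>v\<in>V. B (cscale c u) v = c * B u v \<and> B u (cscale c v) = c * B u v)"

definition k_const :: "nat \<Rightarrow> 'a::field \<Rightarrow> nat \<Rightarrow> 'a" where
  "k_const N p i = of_nat (N choose i) * (p / (1 - p)) ^ i"

lemma bilinear_form_exists:
  fixes g :: "nat \<Rightarrow> 'a::field"
  shows "\<exists>B. bilinear_form_on (Hom N) B \<and>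
    (\<forall>i\<le>N. \<forall>j\<le>N. B (var_y ^ (N - i) * var_z ^ i) (var_y ^ (N - j) * var_z ^ j)
       = (if i = j then g i else 0))"
proof -
  define B where "B u v = (\<Sum>l\<le>N. g l * coeff (coeff u l) (N - l) * coeff (coeff v l) (N - l))"
    for u v :: "'a poly poly"
  have "var_y ^ m = [:monom (1::'a) m:]" for m
    by (induction m) (simp_all add: var_y_def monom_Suc)
  moreover have "var_z ^ i = monom (1::'a poly) i" for i
    by (induction i) (simp_all add: var_z_def monom_Suc)
  ultimately have mon: "var_y ^ m * var_z ^ i = monom (monom (1::'a) m) i" for m i
    by (simp add: smult_monom)
  have "bilinear_form_on (Hom N) B"
    by (simp add: bilinear_form_on_def B_def cscale_def sum_distrib_left algebra_simps
        flip: sum.distrib)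
  moreover have "B (var_y ^ (N - i) * var_z ^ i) (var_y ^ (N - j) * var_z ^ j)
      = (if i = j then g i else 0)" if "i \<le> N" "j \<le> N" for i j
  proof -
    have "B (var_y ^ (N - i) * var_z ^ i) (var_y ^ (N - j) * var_z ^ j)
        = (\<Sum>l\<le>N. if l = i then if i = j then g i else 0 else 0)"
      unfolding B_def mon by (intro sum.cong) auto
    then show ?thesis using that by simp
  qed
  ultimately show ?thesis by blast
qed

end

theory Submission
  imports Defs
begin

text \<open>In the monomial basis the action is tridiagonal, and \<open>dagger p\<close> is transposition conjugated
  by \<open>diag (1 - p, p)\<close>. Hence the claim reduces to the recurrence
  \<open>(j + 1) k\<^sub>j\<^sub>+\<^sub>1 = (N - j) (p / (1 - p)) k\<^sub>j\<close>, together with the fact that feasibility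
  keeps the binomial coefficients nonzero.\<close>

lemma two_neq_zero_if_CHAR_neq_2:
  assumes "CHAR('a::field) \<noteq> 2"
  shows "(2::'a) \<noteq> 0"
proof
  assume "(2::'a) = 0"
  then have "of_nat 2 = (0::'a)" by simp
  then have "CHAR('a) dvd 2" by (simp only: of_nat_eq_0_iff_char_dvd)
  then have "CHAR('a) = 1 \<or> CHAR('a) = 2"
    using two_is_prime_nat unfolding prime_nat_iff by blast
  then show False using assms by simp
qed

text \<open>Fixing \<open>a\<close> and \<open>a^*\<close> forces the values at
  \<open>sl2_e\<close>, \<open>sl2_h\<close> and \<open>sl2_f\<close>, and linearity extends them to
  \<open>sl2\<close>. The diagonal is kept; the off-diagonal entries are swapped and rescaled by
  mutually inverse factors.\<close>

lemma dagger_eq: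
  fixes p :: "'a::field"
  assumes char: "CHAR('a) \<noteq> 2" and p: "p \<noteq> 0" "p \<noteq> 1" and A: "A \<in> sl2"
  shows "dagger p A = vector [vector [A$1$1, (1 - p) / p * A$2$1], vector [p / (1 - p) * A$1$2, A$2$2]]"
proof -
  let ?\<sigma> = "dagger p"
  have \<sigma>: "antiautomorphism ?\<sigma>" "?\<sigma> (sl2_a p) = sl2_a p" "?\<sigma> sl2_astar = sl2_astar"
    using theI'[OF dagger_exists_unique[OF char p]] unfolding dagger_def by blast+
  note v = antiautomorphism_fixing_values[OF two_neq_zero_if_CHAR_neq_2[OF char] p \<sigma>]
  have "?\<sigma> A = smult_mat (A$1$2) (?\<sigma> sl2_e) +
      (smult_mat (A$1$1) (?\<sigma> sl2_h) + smult_mat (A$2$1) (?\<sigma> sl2_f))"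
    using \<sigma>(1) by (subst sl2_expand[OF A])
      (simp add: antiautomorphism_def sl2_closed sl2_basis_in_sl2)
  then show ?thesis
    using A \<sigma>(3) v by (simp add: sl2_astar_def) (simp add: mat2_simps add_eq_0_iff)
qed

lemma derivation_power:
  assumes "derivation D"
  shows "D (x ^ n) = cscale (of_nat n) (x ^ (n - 1) * D x)"
proof (induction n)
  case 0
  \<comment> \<open>The Leibniz rule at \<open>1 * 1\<close> reads \<open>D 1 = D 1 + D 1\<close>,
    which forces \<open>D 1 = 0\<close>.\<close>
  have "D (1 * 1) = D 1 * 1 + 1 * D 1" using assms unfolding derivation_def by blast
  then have "D 1 = 0" by (metis add_cancel_right_right mult.right_neutral mult_1)
  then show ?case by simp
next
  case (Suc n)
  have "D (x ^ Suc n) = D x * x ^ n + x * D (x ^ n)"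
    using assms by (simp add: derivation_def)
  also have "x * D (x ^ n) = cscale (of_nat n) (x ^ n * D x)"
    unfolding Suc.IH by (cases n) (simp_all add: cscale_mult mult.assoc)
  finally show ?case by (simp add: poly2.scale_left_distrib mult.commute)
qed

text \<open>By the Leibniz and power rules, one factor \<open>y\<close> or \<open>z\<close> at a
  time is replaced by its image. The truncated exponents \<open>m - 1\<close> and
  \<open>n - 1\<close> do no harm, since the scalar vanishes when truncation occurs.\<close>

lemma act_monomial:
  "act A (var_y ^ m * var_z ^ n) =
     cscale (A$1$1 * of_nat m + A$2$2 * of_nat n) (var_y ^ m * var_z ^ n)
   + (cscale (A$2$1 * of_nat m) (var_y ^ (m - 1) * var_z ^ Suc n)
   + cscale (A$1$2 * of_nat n) (var_y ^ Suc m * var_z ^ (n - 1)))"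
proof -
  have "act A (var_y ^ m * var_z ^ n)
      = cscale (of_nat m) (var_y ^ (m - 1) * act A var_y) * var_z ^ n
      + var_y ^ m * cscale (of_nat n) (var_z ^ (n - 1) * act A var_z)"
    using act_derivation[of A] unfolding derivation_power[OF act_derivation, symmetric]
    by (simp add: derivation_def)
  then show ?thesis
    by (cases m; cases n)
      (simp_all add: act_vars cscale_mult algebra_simps
        poly2.scale_right_distrib poly2.scale_left_distrib)
qed

lemma act_lin:
  "act A (u + v) = act A u + act A v" "act A (cscale c u) = cscale c (act A u)" "act A 0 = 0"
proof -
  show sc: "act A (cscale c u) = cscale c (act A u)" for c u
    using act_derivation[of A] by (simp add: derivation_def)
  show "act A (u + v) = act A u + act A v"
    using act_derivation[of A] by (simp add: derivation_def)
  show "act A 0 = 0" using sc[of 0 0] by simp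
qed

lemma monomial_in_Hom: "i \<le> N \<Longrightarrow> var_y ^ (N - i) * var_z ^ i \<in> Hom N"
  unfolding Hom_def by (intro poly2.span_base) blast

lemma Hom_closed:
  "0 \<in> Hom N" "u \<in> Hom N \<Longrightarrow> v \<in> Hom N \<Longrightarrow> u + v \<in> Hom N" "u \<in> Hom N \<Longrightarrow> cscale c u \<in> Hom N"
  by (simp_all add: Hom_def poly2.span_zero poly2.span_add poly2.span_scale)

lemma Hom_induct [consumes 1, case_names zero add scale monomial]:
  assumes "u \<in> Hom N" and "P 0"
    and "\<And>u v. u \<in> Hom N \<Longrightarrow> v \<in> Hom N \<Longrightarrow> P u \<Longrightarrow> P v \<Longrightarrow> P (u + v)"
    and "\<And>c u. u \<in> Hom N \<Longrightarrow> P u \<Longrightarrow> P (cscale c u)"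
    and "\<And>i. i \<le> N \<Longrightarrow> P (var_y ^ (N - i) * var_z ^ i)"
  shows "P u"
proof -
  \<comment> \<open>Membership is carried along because the closure assumptions on \<open>P\<close>
    speak only of elements of \<open>Hom N\<close>.\<close>
  have "u \<in> Hom N \<and> P u"
    using assms(1) unfolding Hom_def
  proof (rule poly2.span_induct)
    show "poly2.subspace {u. u \<in> poly2.span {var_y ^ (N - i) * var_z ^ i | i. i \<le> N} \<and> P u}"
      unfolding Hom_def[symmetric] using assms by (auto intro!: poly2.subspaceI Hom_closed)
    show "x \<in> poly2.span {var_y ^ (N - i) * var_z ^ i | i. i \<le> N} \<and> P x"
      if "x \<in> {var_y ^ (N - i) * var_z ^ i | i. i \<le> N}" for x
      using that assms(5) poly2.span_base[OF that] by blast
  qed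
  then show ?thesis ..
qed

text \<open>For \<open>i = 0\<close> and \<open>i = N\<close> an index of a neighbouring monomial leaves the range
  \<open>{0..N}\<close>, but its coefficient is then zero.\<close>

lemma act_Hom_basis:
  assumes "i \<le> N"
  defines "w \<equiv> \<lambda>i. var_y ^ (N - i) * var_z ^ i"
  shows "act A (w i) = cscale (A$1$1 * of_nat (N - i) + A$2$2 * of_nat i) (w i)
    + (cscale (A$2$1 * of_nat (N - i)) (w (Suc i)) + cscale (A$1$2 * of_nat i) (w (i - 1)))"
proof (cases i)
  case (Suc j)
  then have "Suc (N - i) = N - (i - 1)" using assms(1) by simp
  then show ?thesis unfolding w_def act_monomial by simp
qed (use act_monomial[of A N 0] in \<open>simp add: w_def\<close>)

text \<open>The upper neighbour needs its scalar: for \<open>i = N\<close> the monomial is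
  \<open>z^(N+1)\<close>, outside \<open>Hom N\<close>, but the factor \<open>N - i\<close> is zero.
  The lower index \<open>i - 1\<close> truncates to 0 and stays in range.\<close>

lemma cscale_neighbour_in_Hom:
  "i \<le> N \<Longrightarrow> cscale (c * of_nat (N - i)) (var_y ^ (N - Suc i) * var_z ^ Suc i) \<in> Hom N"
  "i \<le> N \<Longrightarrow> cscale (c * of_nat i) (var_y ^ (N - (i - 1)) * var_z ^ (i - 1)) \<in> Hom N"
proof -
  show "cscale (c * of_nat (N - i)) (var_y ^ (N - Suc i) * var_z ^ Suc i) \<in> Hom N" if "i \<le> N"
    using that Hom_closed(3)[OF monomial_in_Hom[of "Suc i" N]]
    by (cases "i = N") (simp_all add: Hom_closed(1) Suc_le_eq)
  show "cscale (c * of_nat i) (var_y ^ (N - (i - 1)) * var_z ^ (i - 1)) \<in> Hom N" if "i \<le> N"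
    using that by (intro Hom_closed(3) monomial_in_Hom) simp
qed

text \<open>The form is known to be bilinear only on \<open>Hom N\<close>, so this invariance is
  what permits expanding it at \<open>act A u\<close>.\<close>

lemma act_in_Hom: "u \<in> Hom N \<Longrightarrow> act A u \<in> Hom N"
proof (induction rule: Hom_induct)
  case (monomial i)
  then show ?case
    unfolding act_Hom_basis[OF monomial]
    by (intro Hom_closed(2) cscale_neighbour_in_Hom Hom_closed(3)[OF monomial_in_Hom])
qed (simp_all add: act_lin Hom_closed)

lemma bilinear_form_onD:
  assumes "bilinear_form_on (Hom N) B" "u \<in> Hom N" "v \<in> Hom N"
  shows "w \<in> Hom N \<Longrightarrow> B (u + v) w = B u w + B v w" "w \<in> Hom N \<Longrightarrow> B w (u + v) = B w u + B w v"
    "B (cscale c u) v = c * B u v" "B u (cscale c v) = c * B u v"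
  using assms unfolding bilinear_form_on_def by blast+

lemma bilinear_form_on_zero:
  assumes "bilinear_form_on (Hom N) B" "u \<in> Hom N"
  shows "B 0 u = 0" "B u 0 = 0"
  using bilinear_form_onD(3)[OF assms(1) Hom_closed(1) assms(2), of 0]
    bilinear_form_onD(4)[OF assms(1,2) Hom_closed(1), of 0] by simp_all

text \<open>Since distinct monomials are orthogonal, pairing with \<open>w j\<close> extracts the
  coefficient of \<open>w j\<close> in \<open>act A (w i)\<close> and multiplies it by
  \<open>g j\<close>. Both argument orders are covered, as the adjointness identity has the action
  in either slot.\<close>

lemma bilinear_act_basis:
  fixes g :: "nat \<Rightarrow> 'a::field"
  assumes B: "bilinear_form_on (Hom N) B" and le: "i \<le> N" "j \<le> N"
  defines "w \<equiv> \<lambda>i. var_y ^ (N - i) * var_z ^ i"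
  assumes g: "\<And>i j. i \<le> N \<Longrightarrow> j \<le> N \<Longrightarrow> B (w i) (w j) = (if i = j then g i else 0)"
  defines "c \<equiv> \<lambda>A i j. if i = j then (A$1$1 * of_nat (N - i) + A$2$2 * of_nat i) * g j
    else if j = Suc i then A$2$1 * of_nat (N - i) * g j
    else if i = Suc j then A$1$2 * of_nat i * g j else 0"
  shows "B (act A (w i)) (w j) = c A i j" "B (w j) (act A (w i)) = c A i j"
proof -
  note D = bilinear_form_onD[OF B] bilinear_form_on_zero[OF B]
  have w: "w i \<in> Hom N" if "i \<le> N" for i
    using that unfolding w_def by (rule monomial_in_Hom)
  have mem: "cscale (x * of_nat (N - i)) (w (Suc i)) \<in> Hom N"
    "cscale (x * of_nat i) (w (i - 1)) \<in> Hom N" for x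
    unfolding w_def by (rule cscale_neighbour_in_Hom[OF le(1)])+
  have up: "B (cscale (x * of_nat (N - i)) (w (Suc i))) (w j) = (if j = Suc i then x * of_nat (N - i) * g j else 0)"
    "B (w j) (cscale (x * of_nat (N - i)) (w (Suc i))) = (if j = Suc i then x * of_nat (N - i) * g j else 0)" for x
    \<comment> \<open>For \<open>i = N\<close> the assumption on \<open>g\<close> does not reach
      \<open>w (Suc i)\<close>, but the scalar is zero, and \<open>j = Suc i\<close> is excluded by
      \<open>j \<le> N\<close>.\<close>
    using le by (cases "i = N"; simp add: D w g)+
  have down: "B (cscale (x * of_nat i) (w (i - 1))) (w j) = (if i = Suc j then x * of_nat i * g j else 0)"
    "B (w j) (cscale (x * of_nat i) (w (i - 1))) = (if i = Suc j then x * of_nat i * g j else 0)" for x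
    using le by (cases i; simp add: D w g)+
  have act: "act A (w i) = cscale (A$1$1 * of_nat (N - i) + A$2$2 * of_nat i) (w i)
    + (cscale (A$2$1 * of_nat (N - i)) (w (Suc i)) + cscale (A$1$2 * of_nat i) (w (i - 1)))"
    unfolding w_def by (rule act_Hom_basis[OF le(1)])
  have split: "B (x + (y + z)) v = B x v + (B y v + B z v)" "B v (x + (y + z)) = B v x + (B v y + B v z)"
    if "x \<in> Hom N" "y \<in> Hom N" "z \<in> Hom N" "v \<in> Hom N" for x y z v
    using that by (simp_all add: D Hom_closed)
  note split = split[OF Hom_closed(3)[OF w[OF le(1)]] mem w[OF le(2)]]
  show "B (act A (w i)) (w j) = c A i j" "B (w j) (act A (w i)) = c A i j"
    unfolding act split up down c_def by (simp_all add: D w g le)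
qed

text \<open>The binomial coefficient divides \<open>fact N\<close>. A positive characteristic is
  prime, and a prime dividing \<open>fact N\<close> is at most \<open>N\<close>, contrary to
  feasibility.\<close>

lemma of_nat_binomial_neq_0:
  assumes "feasible TYPE('a::field) N" "i \<le> N"
  shows "of_nat (N choose i) \<noteq> (0::'a)"
proof
  assume "of_nat (N choose i) = (0::'a)"
  then have "CHAR('a) dvd N choose i" by (simp only: of_nat_eq_0_iff_char_dvd)
  moreover have "N choose i dvd fact N"
    using binomial_fact_lemma[OF assms(2)] by (metis dvd_triv_right)
  ultimately have dvd: "CHAR('a) dvd fact N" by (rule dvd_trans)
  \<comment> \<open>Characteristic 0 would give \<open>0 dvd fact N\<close>, although
    \<open>fact N\<close> is nonzero.\<close>
  then have "CHAR('a) > 0" by (intro gr0I) simp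
  then have "prime CHAR('a)" by (rule prime_CHAR_semidom)
  then have "CHAR('a) \<le> N" using dvd by (simp add: prime_dvd_fact_iff)
  then show False using assms(1) \<open>CHAR('a) > 0\<close> by (simp add: feasible_def)
qed

lemma k_const_neq_0:
  assumes "feasible TYPE('a::field) N" "i \<le> N" "p \<noteq> 0" "p \<noteq> (1::'a)"
  shows "k_const N p i \<noteq> 0"
  using of_nat_binomial_neq_0[OF assms(1,2)] assms(3,4) by (simp add: k_const_def)

lemma k_const_Suc:
  "of_nat (Suc j) * k_const N p (Suc j) = p / (1 - p) * of_nat (N - j) * k_const N p j"
proof -
  \<comment> \<open>Both sides equal \<open>N * ((N - 1) choose j)\<close>.\<close>
  have "Suc j * (N choose Suc j) = (N - j) * (N choose j)"
    by (metis binomial_absorb_comp binomial_absorption)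
  then have "of_nat (Suc j) * of_nat (N choose Suc j) = (of_nat (N - j) * of_nat (N choose j) :: 'a)"
    by (metis of_nat_mult)
  then have "of_nat (Suc j) * of_nat (N choose Suc j) * (p / (1 - p)) ^ Suc j
      = of_nat (N - j) * of_nat (N choose j) * (p / (1 - p)) ^ Suc j"
    by simp
  then show ?thesis unfolding k_const_def power_Suc by (simp only: ac_simps)
qed

theorem lemma3p12:
  fixes p :: "'a::alg_closed_field" and N :: nat
    and B :: "'a poly poly \<Rightarrow> 'a poly poly \<Rightarrow> 'a"
  assumes "CHAR('a) \<noteq> 2"
    and "p \<noteq> 0" and "p \<noteq> 1"
    and "feasible TYPE('a) N"
    and "bilinear_form_on (Hom N) B"
    and "\<And>i j. i \<le> N \<Longrightarrow> j \<le> N \<Longrightarrow>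
           B (var_y ^ (N - i) * var_z ^ i) (var_y ^ (N - j) * var_z ^ j)
             = (if i = j then 1 / (k_const N p i * (1 - p) ^ N) else 0)"
  shows "\<forall>\<phi>\<in>sl2. \<forall>u\<in>Hom N. \<forall>v\<in>Hom N. B (act \<phi> u) v = B u (act (dagger p \<phi>) v)"
proof (intro ballI)
  fix \<phi> :: "'a ^ 2 ^ 2" and u v :: "'a poly poly"
  assume \<phi>: "\<phi> \<in> sl2" and u: "u \<in> Hom N" and v: "v \<in> Hom N"
  define g where "g i = 1 / (k_const N p i * (1 - p) ^ N)" for i
  define w :: "nat \<Rightarrow> 'a poly poly" where "w i = var_y ^ (N - i) * var_z ^ i" for i
  define \<psi> where "\<psi> = dagger p \<phi>"
  have \<psi>: "\<psi>$1$1 = \<phi>$1$1" "\<psi>$2$2 = \<phi>$2$2"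
    "\<psi>$1$2 = (1 - p) / p * \<phi>$2$1" "\<psi>$2$1 = p / (1 - p) * \<phi>$1$2"
    unfolding \<psi>_def dagger_eq[OF assms(1-3) \<phi>] by simp_all
  have q: "1 - p \<noteq> 0" using assms(3) by simp
  \<comment> \<open>This is \<open>k_const_Suc\<close> divided by
    \<open>k_const N p j * k_const N p (Suc j) * (1 - p) ^ N\<close>; passing to reciprocals
    interchanges the two indices.\<close>
  have rec: "of_nat (Suc j) * g j = p / (1 - p) * of_nat (N - j) * g (Suc j)" if "Suc j \<le> N" for j
  proof -
    have "k_const N p j \<noteq> 0" "k_const N p (Suc j) \<noteq> 0"
      using that assms k_const_neq_0[of N _ p] by simp_all
    then show ?thesis
      using k_const_Suc[of j N p] q unfolding g_def
      by (simp add: divide_simps del: of_nat_Suc of_nat_diff) (simp only: ac_simps)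
  qed
  note basis = bilinear_act_basis[OF assms(5), where g = g, unfolded g_def, OF _ _ assms(6), folded g_def w_def]
  note D = bilinear_form_onD[OF assms(5)] bilinear_form_on_zero[OF assms(5)]
  have mon: "B (act \<phi> (w i)) (w j) = B (w i) (act \<psi> (w j))"
    if ij: "i \<le> N" "j \<le> N" for i j
  proof -
    \<comment> \<open>The diagonal case holds because \<open>\<phi>\<close> and
      \<open>\<psi>\<close> have the same diagonal; nonadjacent indices give 0 on both sides.
      Adjacent indices compare opposite off-diagonal entries, and \<open>rec\<close> absorbs their
      ratio.\<close>
    consider "i = j" | "i = Suc j" | "j = Suc i" | "i \<noteq> j" "i \<noteq> Suc j" "j \<noteq> Suc i" by blast
    then show ?thesis
    proof cases
      case 2
      then show ?thesis
        using ij rec[of j]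
        by (simp add: basis \<psi> mult.assoc del: of_nat_Suc of_nat_diff)
    next
      case 3
      \<comment> \<open>Here the ratio is the inverse one, so \<open>rec\<close> is solved for its
        right-hand factor by multiplying with \<open>(1 - p) / p\<close>.\<close>
      then have "of_nat (N - i) * g j = (1 - p) / p * (of_nat j * g i)"
        using ij rec[of i] assms(2) q by (simp del: of_nat_Suc of_nat_diff)
      with 3 show ?thesis
        using ij by (simp add: basis \<psi> mult.assoc mult.left_commute[of _ "\<phi>$2$1"] del: of_nat_Suc of_nat_diff)
    qed (use ij in \<open>simp_all add: basis \<psi> del: of_nat_Suc of_nat_diff\<close>)
  qed
  have "B (act \<phi> u) v = B u (act \<psi> v)"
    using u
  \<comment> \<open>Bilinear extension from monomials: first in \<open>u\<close> with
    \<open>v\<close> fixed, then in \<open>v\<close> for each monomial \<open>u\<close>.\<close>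
  proof (induction rule: Hom_induct)
    case (monomial i)
    note w = monomial_in_Hom[OF monomial]
    show ?case
      using v by (induction rule: Hom_induct)
        (simp_all add: act_lin D act_in_Hom w mon[unfolded w_def] monomial)
  qed (use v in \<open>simp_all add: act_lin D act_in_Hom\<close>)
  then show "B (act \<phi> u) v = B u (act (dagger p \<phi>) v)"
    by (simp only: \<psi>_def)
qed

end
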